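(* Let $q$ be a prime power and $n$ a positive integer with $\gcd(n,q)=1$. Let $E=\{e_1(x),\dots,e_t(x)\}$ be the set of primitive idempotents of $R_{q,n}=\mathbb{F}_q[x]/\langle x^n-1\rangle$. Let $F(x)=\sum_{i=0}^{n-1} a_i x^{q^i}$, with $a_i\in\mathbb{F}_q$, be a linear permutation over $\mathbb{F}_{q^n}$, and let $f(x)=\sum_{i=0}^{n-1} a_i x^i$ be its conventional $q$-associate. Then $f(x)$ can be written as $$f(x)\equiv \sum_{i=1}^t f_i(x)e_i(x) \mod x^n-1,$$ where $f_i(x)\in R_{q,n}$ and $\gcd(f_i(x),x^n-1)=1$ for $1\le i\le t$. Furthermore, the conventional $q$-associate $f^{-1}(x)$ of the compositional inverse of $F(x)$ is given by $$f^{-1}(x)\equiv \sum_{i=1}^t f_i^{-1}(x)e_i(x) \mod x^n-1.$$ Every polynomial $f(x)$ (respectively $f^{-1}(x)$) is uniquely determined by the vector $(f_1(x),\dots,f_t(x))$ (respectively $(f_1^{-1}(x),\dots,f_t^{-1}(x))$).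
   Context: A polynomial $F(x)=\sum_{i=0}^{n-1} a_i x^{q^i}$ is a linear permutation over $\mathbb{F}_{q^n}$ if the map $\mathbb{F}_{q^n}\to\mathbb{F}_{q^n}$, $c\mapsto F(c)$, is a bijection; its compositional inverse is the polynomial $F^{-1}(x)$ of degree less than $q^n$ with $F\circ F^{-1}\equiv F^{-1}\circ F\equiv x \mod x^{q^n}-x$. The conventional $q$-associate of $\sum_{i=0}^{n-1} a_i x^{q^i}$ is $\sum_{i=0}^{n-1} a_i x^i$. For a polynomial $f_i(x)$ coprime to $x^n-1$, $f_i^{-1}(x)$ denotes its multiplicative inverse in the ring $R_{q,n}$. Since $\gcd(n,q)=1$, the ring $R_{q,n}$ is semisimple; its primitive idempotents are the nonzero idempotents $e$ that cannot be written as $e=\overline{e}+\tilde{e}$ with $\overline{e},\tilde{e}$ nonzero idempotents satisfying $\overline{e}\,\tilde{e}=0$. They are pairwise orthogonal and sum to $1$. Elements of $R_{q,n}$ are identified with polynomials of degree less than $n$. *)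

theory Defs
  imports
    "HOL-Library.Cardinality"
    "HOL-Algebra.Ring"
    "HOL-Number_Theory.Cong"
    "HOL-Number_Theory.Prime_Powers"
    "HOL-Computational_Algebra.Polynomial"
begin

abbreviation cyclic_modulus :: "nat \<Rightarrow> 'a :: field poly" where
  "cyclic_modulus n \<equiv> monom 1 n - 1"

text \<open>
  The quotient of the polynomial ring over a field by the ideal generated by \<open>x ^ n - 1\<close>,
  for \<open>n > 0\<close>, with every residue class represented by its unique member of degree less than \<open>n\<close>.
\<close>

definition cyclic_ring :: "nat \<Rightarrow> 'a :: field poly ring" where
  "cyclic_ring n =
     \<lparr>carrier = {p. degree p < n},
      monoid.mult = (\<lambda>p r. (p * r) mod cyclic_modulus n),
      one = 1,
      zero = 0,
      add = (+)\<rparr>"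

definition idempotents :: "('a, 'm) ring_scheme \<Rightarrow> 'a set" where
  "idempotents R = {e \<in> carrier R. e \<otimes>\<^bsub>R\<^esub> e = e}"

definition primitive_idempotents :: "('a, 'm) ring_scheme \<Rightarrow> 'a set" where
  "primitive_idempotents R =
     {e \<in> idempotents R - {\<zero>\<^bsub>R\<^esub>}.
        \<not> (\<exists>u \<in> idempotents R - {\<zero>\<^bsub>R\<^esub>}. \<exists>v \<in> idempotents R - {\<zero>\<^bsub>R\<^esub>}.
             u \<otimes>\<^bsub>R\<^esub> v = \<zero>\<^bsub>R\<^esub> \<and> e = u \<oplus>\<^bsub>R\<^esub> v)}"

definition coprime_family :: "nat \<Rightarrow> nat \<Rightarrow> (nat \<Rightarrow> 'a :: field poly) \<Rightarrow> bool" where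
  "coprime_family n t fs \<longleftrightarrow>
     (\<forall>i\<in>{1..t}. fs i \<in> carrier (cyclic_ring n) \<and> coprime (fs i) (cyclic_modulus n))"

definition q_polynomial :: "nat \<Rightarrow> nat \<Rightarrow> (nat \<Rightarrow> 'a :: comm_ring_1) \<Rightarrow> 'a poly" where
  "q_polynomial q n a = (\<Sum>i<n. monom (a i) (q ^ i))"

text \<open>The conventional \<open>q\<close>-associate of \<open>q_polynomial q n a\<close>.\<close>

definition q_associate :: "nat \<Rightarrow> (nat \<Rightarrow> 'a :: comm_ring_1) \<Rightarrow> 'a poly" where
  "q_associate n a = (\<Sum>i<n. monom (a i) i)"

definition permutation_polynomial :: "'a :: comm_ring_1 poly \<Rightarrow> bool" where
  "permutation_polynomial F \<longleftrightarrow> bij (poly F)"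

text \<open>
  Over the field with \<open>N\<close> elements; meaningful only for permutation polynomials, for which the
  polynomial described exists and is unique.
\<close>

definition compositional_inverse :: "nat \<Rightarrow> 'a :: field poly \<Rightarrow> 'a poly" where
  "compositional_inverse N F =
     (THE G. degree G < N \<and>
        [F \<circ>\<^sub>p G = monom 1 1] (mod (monom 1 N - monom 1 1)) \<and>
        [G \<circ>\<^sub>p F = monom 1 1] (mod (monom 1 N - monom 1 1)))"

lemma degree_cyclic_modulus:
  "n > 0 \<Longrightarrow> degree (cyclic_modulus n :: 'a :: field poly) = n"
  using degree_add_eq_left[of "- 1" "monom (1 :: 'a) n"] by (simp add: degree_monom_eq)

lemma cring_cyclic_ring:
  assumes "n > 0"
  shows "cring (cyclic_ring n :: 'a :: field poly ring)"
proof -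
  let ?m = "cyclic_modulus n :: 'a poly"
  have deg: "degree ?m = n"
    using assms by (rule degree_cyclic_modulus)
  have closed: "degree (p mod ?m) < n" for p
  proof (cases "p mod ?m = 0")
    case False
    then show ?thesis
      using degree_mod_less[of ?m p] assms deg by fastforce
  qed (use assms in simp)
  have reduced: "p mod ?m = p" if "degree p < n" for p
    using that deg by (simp add: mod_poly_less)
  show ?thesis
  proof (rule cringI)
    show "abelian_group (cyclic_ring n :: 'a poly ring)"
    proof (rule abelian_groupI)
      fix p :: "'a poly" assume "p \<in> carrier (cyclic_ring n)"
      then show "\<exists>r \<in> carrier (cyclic_ring n). r \<oplus>\<^bsub>cyclic_ring n\<^esub> p = \<zero>\<^bsub>cyclic_ring n\<^esub>"
        by (intro bexI[of _ "- p"]) (auto simp: cyclic_ring_def)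
    qed (auto simp: cyclic_ring_def degree_add_less assms)
    show "comm_monoid (cyclic_ring n :: 'a poly ring)"
      by (rule comm_monoidI)
        (auto simp: cyclic_ring_def closed reduced assms mod_mult_left_eq
          mod_mult_right_eq ac_simps)
  qed (auto simp: cyclic_ring_def distrib_right poly_mod_add_left)
qed

end

theory Submission
  imports "HOL-Number_Theory.Residues" Defs
begin

text \<open>
  Let a polynomial \<open>p\<close> over the small field act on the large field by
  \<open>c \<mapsto> \<Sum> p\<^sub>i c ^ (q ^ i)\<close>, that is, let \<open>x\<close> act as the Frobenius map \<open>c \<mapsto> c ^ q\<close>.  The coefficients
  are fixed by the Frobenius map, so products of polynomials act as composites (\<open>operator_mult\<close>).
  Since \<open>c ^ (q ^ n) = c\<close>, the polynomial \<open>x ^ n - 1\<close> acts as zero (\<open>operator_cyclic_modulus\<close>) and the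
  cyclic ring acts.  The action is faithful (\<open>operator_faithful\<close>): a nonzero linearized polynomial of
  degree below \<open>q ^ n\<close> cannot vanish on all \<open>q ^ n\<close> elements.  The polynomial \<open>F\<close> acts as its
  associate \<open>f\<close>, so if \<open>F\<close> permutes the field then multiplication by \<open>f\<close> is injective on the cyclic
  ring; the ring being finite, \<open>f\<close> has an inverse \<open>g\<close> there (\<open>ex_cong_inverse_if_operator_inj\<close>).  Then
  the linearized polynomial with associate \<open>g\<close> is the compositional inverse of \<open>F\<close>
  (\<open>compositional_inverse_q_polynomial\<close>).

  It remains to compute \<open>g\<close> componentwise.  In any commutative ring with finitely many idempotents the
  primitive ones are orthogonal with sum 1, so multiplying \<open>\<Sum> f\<^sub>i e\<^sub>i\<close> by the combination of the
  inverses of the \<open>f\<^sub>i\<close> gives \<open>\<Sum> e\<^sub>i = 1\<close> (\<open>combination_mult_inverse_combination\<close>).  As inverses in the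
  ring are unique, that combination is \<open>g\<close>.  A decomposition of \<open>f\<close> itself exists because the constant
  family \<open>f\<^sub>i = f\<close> is one: \<open>\<Sum> f e\<^sub>i = f\<close>, and \<open>f\<close> is a unit.
\<close>

section \<open>Primitive idempotents of a commutative ring\<close>

lemma idempotentsD:
  assumes "e \<in> idempotents R"
  shows "e \<in> carrier R" and "e \<otimes>\<^bsub>R\<^esub> e = e"
  using assms by (auto simp: idempotents_def)

lemma primitive_idempotentsD:
  assumes "e \<in> primitive_idempotents R"
  shows "e \<in> idempotents R" and "e \<noteq> \<zero>\<^bsub>R\<^esub>"
  using assms by (auto simp: primitive_idempotents_def)

lemma primitive_idempotent_indecomposable:
  assumes "e \<in> primitive_idempotents R" and "u \<in> idempotents R" and "v \<in> idempotents R"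
    and "u \<otimes>\<^bsub>R\<^esub> v = \<zero>\<^bsub>R\<^esub>" and "e = u \<oplus>\<^bsub>R\<^esub> v"
  shows "u = \<zero>\<^bsub>R\<^esub> \<or> v = \<zero>\<^bsub>R\<^esub>"
  using assms unfolding primitive_idempotents_def by blast

context cring
begin

lemma idempotents_mult:
  assumes "u \<in> idempotents R" and "v \<in> idempotents R"
  shows "u \<otimes> v \<in> idempotents R"
proof -
  note u = idempotentsD[OF assms(1)] and v = idempotentsD[OF assms(2)]
  have "(u \<otimes> v) \<otimes> (u \<otimes> v) = (u \<otimes> u) \<otimes> (v \<otimes> v)"
    using u(1) v(1) by (simp add: m_ac)
  then show ?thesis
    using u v by (simp add: idempotents_def)
qed

lemma idempotents_complement:
  assumes "u \<in> idempotents R"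
  shows "\<one> \<ominus> u \<in> idempotents R" and "u \<otimes> (\<one> \<ominus> u) = \<zero>"
proof -
  note u = idempotentsD[OF assms]
  show zero: "u \<otimes> (\<one> \<ominus> u) = \<zero>"
    using u by (simp add: minus_eq r_distr r_minus r_neg)
  have "(\<one> \<ominus> u) \<otimes> (\<one> \<ominus> u) = (\<one> \<ominus> u) \<ominus> u \<otimes> (\<one> \<ominus> u)"
    using u(1) by (simp add: minus_eq l_distr l_minus)
  also have "\<dots> = \<one> \<ominus> u"
    using u(1) unfolding zero by (simp add: minus_eq)
  finally show "\<one> \<ominus> u \<in> idempotents R"
    using u(1) by (simp add: idempotents_def)
qed

text \<open>
  An idempotent \<open>u\<close> splits \<open>e\<close> into the orthogonal idempotents \<open>e u\<close> and \<open>e (1 - u)\<close>, and one of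
  the two must vanish when \<open>e\<close> is primitive: primitive idempotents are the atoms of the Boolean
  algebra of idempotents.
\<close>

lemma primitive_idempotent_mult_cases:
  assumes e: "e \<in> primitive_idempotents R" and u: "u \<in> idempotents R"
  shows "e \<otimes> u = \<zero> \<or> e \<otimes> u = e"
proof -
  note e' = idempotentsD[OF primitive_idempotentsD(1)[OF e]] and u' = idempotentsD[OF u]
  note c = idempotents_complement[OF u]
  have split: "e = e \<otimes> u \<oplus> e \<otimes> (\<one> \<ominus> u)"
  proof -
    have "e \<otimes> u \<oplus> e \<otimes> (\<one> \<ominus> u) = e \<otimes> (u \<oplus> (\<one> \<ominus> u))"
      using e'(1) u'(1) by (simp add: r_distr)
    also have "u \<oplus> (\<one> \<ominus> u) = \<one>"
      using u'(1) by algebra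
    finally show ?thesis
      using e'(1) by simp
  qed
  have "(e \<otimes> u) \<otimes> (e \<otimes> (\<one> \<ominus> u)) = (e \<otimes> e) \<otimes> (u \<otimes> (\<one> \<ominus> u))"
    using e'(1) u'(1) by (simp add: m_ac)
  also have "\<dots> = \<zero>"
    using e'(1) c(2) by simp
  finally have "e \<otimes> u = \<zero> \<or> e \<otimes> (\<one> \<ominus> u) = \<zero>"
    using primitive_idempotent_indecomposable[OF e _ _ _ split]
      idempotents_mult[OF primitive_idempotentsD(1)[OF e]] u c(1) by blast
  then show ?thesis
    using split e'(1) u'(1) by auto
qed

lemma primitive_idempotents_orthogonal:
  assumes "e \<in> primitive_idempotents R" and "e' \<in> primitive_idempotents R" and "e \<noteq> e'"
  shows "e \<otimes> e' = \<zero>"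
proof -
  have "e \<in> carrier R" "e' \<in> carrier R"
    using assms(1,2) by (auto dest: primitive_idempotentsD idempotentsD)
  then have "e \<otimes> e' = e' \<otimes> e"
    by (rule m_comm)
  then show ?thesis
    using primitive_idempotent_mult_cases[OF assms(1) primitive_idempotentsD(1)[OF assms(2)]]
      primitive_idempotent_mult_cases[OF assms(2) primitive_idempotentsD(1)[OF assms(1)]] assms(3)
    by auto
qed

text \<open>
  A decomposable \<open>u = v + w\<close> strictly dominates \<open>v\<close> in the order \<open>x \<le> u \<longleftrightarrow> x u = x\<close>, so with
  finitely many idempotents the descent through proper summands ends at a primitive one.
\<close>

lemma ex_primitive_idempotent_below:
  assumes fin: "finite (idempotents R)" and "u \<in> idempotents R" and "u \<noteq> \<zero>"
  shows "\<exists>e\<in>primitive_idempotents R. e \<otimes> u = e"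
  using assms(2,3)
proof (induction "card {x \<in> idempotents R. x \<otimes> u = x}" arbitrary: u rule: less_induct)
  case less
  note u = idempotentsD[OF less.prems(1)]
  show ?case
  proof (cases "u \<in> primitive_idempotents R")
    case True
    then show ?thesis using u by blast
  next
    case False
    then obtain v w where v: "v \<in> idempotents R" "v \<noteq> \<zero>" and w: "w \<in> idempotents R" "w \<noteq> \<zero>"
      and orth: "v \<otimes> w = \<zero>" and sum: "u = v \<oplus> w"
      using less.prems unfolding primitive_idempotents_def by blast
    note v' = idempotentsD[OF v(1)] and w' = idempotentsD[OF w(1)]
    have vu: "v \<otimes> u = v"
      using v' w'(1) orth by (simp add: sum r_distr)
    have trans: "x \<otimes> u = x" if "x \<in> carrier R" "x \<otimes> v = x" for x
      using that v'(1) u(1) vu m_assoc[of x v u] by simp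
    have "u \<otimes> v \<noteq> u"
    proof
      assume "u \<otimes> v = u"
      then have "v \<oplus> w = v"
        using vu v'(1) u(1) m_comm sum by simp
      then show False
        using v'(1) w'(1) w(2) add.r_cancel_one by simp
    qed
    then have "{x \<in> idempotents R. x \<otimes> v = x} \<subset> {x \<in> idempotents R. x \<otimes> u = x}"
      using less.prems(1) u trans by (auto dest: idempotentsD)
    then have "card {x \<in> idempotents R. x \<otimes> v = x} < card {x \<in> idempotents R. x \<otimes> u = x}"
      by (intro psubset_card_mono) (use fin in auto)
    then obtain e where "e \<in> primitive_idempotents R" "e \<otimes> v = e"
      using less.hyps v by blast
    then show ?thesis
      using trans by (auto dest: primitive_idempotentsD idempotentsD)
  qed
qed

text \<open>
  Multiplying by one primitive idempotent annihilates all other components; this turns every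
  computation with combinations of primitive idempotents into a componentwise one.
\<close>

lemma primitive_idempotent_mult_combination:
  assumes I: "finite I" and e: "bij_betw e I (primitive_idempotents R)"
    and u: "\<And>i. i \<in> I \<Longrightarrow> u i \<in> carrier R" and k: "k \<in> I"
  shows "e k \<otimes> (\<Oplus>i\<in>I. u i \<otimes> e i) = u k \<otimes> e k"
proof -
  have prim: "e i \<in> primitive_idempotents R" if "i \<in> I" for i
    using e that by (auto simp: bij_betw_def)
  have idem: "e i \<in> carrier R" "e i \<otimes> e i = e i" if "i \<in> I" for i
    using idempotentsD[OF primitive_idempotentsD(1)[OF prim[OF that]]] by auto
  have "e k \<otimes> (\<Oplus>i\<in>I. u i \<otimes> e i) = (\<Oplus>i\<in>I. e k \<otimes> (u i \<otimes> e i))"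
    using I idem u k by (intro finsum_rdistr) auto
  also have "\<dots> = (\<Oplus>i\<in>I. if k = i then u i \<otimes> e i else \<zero>)"
  proof (intro finsum_cong' Pi_I refl)
    fix i assume i: "i \<in> I"
    have "e k \<otimes> (u i \<otimes> e i) = u i \<otimes> (e k \<otimes> e i)"
      using idem u i k by (simp add: m_lcomm)
    moreover have "e k \<otimes> e i = \<zero>" if "k \<noteq> i"
      using primitive_idempotents_orthogonal[OF prim[OF k] prim[OF i]] that e i k
      by (auto simp: bij_betw_def inj_on_def)
    ultimately show "e k \<otimes> (u i \<otimes> e i) = (if k = i then u i \<otimes> e i else \<zero>)"
      using idem u i by auto
  qed (use idem u in auto)
  also have "\<dots> = u k \<otimes> e k"
    using I idem u k by (intro add.finprod_singleton) auto
  finally show ?thesis .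
qed

text \<open>
  The sum \<open>s\<close> of all primitive idempotents is idempotent and fixes each of them.  A nonzero \<open>1 - s\<close>
  would dominate some primitive idempotent, which \<open>1 - s\<close> annihilates.
\<close>

lemma finsum_primitive_idempotents:
  assumes fin: "finite (idempotents R)" and I: "finite I"
    and e: "bij_betw e I (primitive_idempotents R)"
  shows "(\<Oplus>i\<in>I. e i) = \<one>"
proof -
  let ?s = "\<Oplus>i\<in>I. e i"
  have idem: "e i \<in> carrier R" if "i \<in> I" for i
    using e that by (auto simp: bij_betw_def dest: primitive_idempotentsD idempotentsD)
  then have s: "?s \<in> carrier R"
    by auto
  have fix_e: "e k \<otimes> ?s = e k" if "k \<in> I" for k
  proof -
    have "?s = (\<Oplus>i\<in>I. \<one> \<otimes> e i)"
      by (intro finsum_cong') (use idem in auto)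
    then show ?thesis
      using primitive_idempotent_mult_combination[OF I e, of "\<lambda>_. \<one>" k] that idem by simp
  qed
  have "?s \<otimes> ?s = (\<Oplus>i\<in>I. e i \<otimes> ?s)"
    using I s idem by (intro finsum_ldistr) auto
  also have "\<dots> = ?s"
    by (intro finsum_cong') (use fix_e idem in auto)
  finally have s_idem: "?s \<in> idempotents R"
    using s by (simp add: idempotents_def)
  have "\<one> \<ominus> ?s = \<zero>"
  proof (rule ccontr)
    assume "\<one> \<ominus> ?s \<noteq> \<zero>"
    then obtain p where p: "p \<in> primitive_idempotents R" "p \<otimes> (\<one> \<ominus> ?s) = p"
      using ex_primitive_idempotent_below[OF fin idempotents_complement(1)[OF s_idem]] by blast
    then obtain k where k: "k \<in> I" "p = e k"
      using e by (auto simp: bij_betw_def)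
    have "p \<otimes> (\<one> \<ominus> ?s) = p \<ominus> p \<otimes> ?s"
      using s idem k by (simp add: minus_eq r_distr r_minus)
    also have "\<dots> = \<zero>"
      using fix_e idem k by (simp add: minus_eq r_neg)
    finally show False
      using p primitive_idempotentsD(2) by force
  qed
  then show ?thesis
    using s by simp
qed

text \<open>
  Cross terms vanish by orthogonality and each diagonal term contributes one \<open>e\<^sub>i\<close>, so the product
  collapses to the sum of all primitive idempotents.
\<close>

lemma combination_mult_inverse_combination:
  assumes fin: "finite (idempotents R)" and I: "finite I"
    and e: "bij_betw e I (primitive_idempotents R)"
    and u: "\<And>i. i \<in> I \<Longrightarrow> u i \<in> Units R"
  shows "(\<Oplus>i\<in>I. u i \<otimes> e i) \<otimes> (\<Oplus>i\<in>I. inv (u i) \<otimes> e i) = \<one>"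
proof -
  let ?g = "\<Oplus>i\<in>I. inv (u i) \<otimes> e i"
  have idem: "e i \<in> carrier R" if "i \<in> I" for i
    using e that by (auto simp: bij_betw_def dest: primitive_idempotentsD idempotentsD)
  have u': "u i \<in> carrier R" "inv (u i) \<in> carrier R" if "i \<in> I" for i
    using u[OF that] by auto
  have g: "?g \<in> carrier R"
    using idem u' by auto
  have "(\<Oplus>i\<in>I. u i \<otimes> e i) \<otimes> ?g = (\<Oplus>i\<in>I. (u i \<otimes> e i) \<otimes> ?g)"
    using I g idem u' by (intro finsum_ldistr) auto
  also have "\<dots> = (\<Oplus>i\<in>I. e i)"
  proof (intro finsum_cong' Pi_I refl)
    fix i assume i: "i \<in> I"
    have "(u i \<otimes> e i) \<otimes> ?g = u i \<otimes> (e i \<otimes> ?g)"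
      using g idem u' i by (intro m_assoc) auto
    also have "\<dots> = u i \<otimes> (inv (u i) \<otimes> e i)"
      using primitive_idempotent_mult_combination[OF I e, of "\<lambda>i. inv (u i)" i] u' i by simp
    also have "\<dots> = (u i \<otimes> inv (u i)) \<otimes> e i"
      using idem u' i by (intro m_assoc[symmetric]) auto
    also have "\<dots> = e i"
      using u idem i by simp
    finally show "(u i \<otimes> e i) \<otimes> ?g = e i" .
  qed (use idem in auto)
  also have "\<dots> = \<one>"
    by (rule finsum_primitive_idempotents[OF fin I e])
  finally show ?thesis .
qed

end

section \<open>The cyclic ring over a finite field\<close>

text \<open>
  The Euclidean algorithm keeps the common divisors of its arguments, so its last nonzero remainder \<open>d\<close>
  divides both and is a combination of them.  For coprime \<open>a\<close> and \<open>b\<close> any such \<open>d\<close> is a unit.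
\<close>

lemma bezout_common_divisor:
  fixes a b :: "'a :: euclidean_ring"
  shows "\<exists>d x y. d dvd a \<and> d dvd b \<and> a * x + b * y = d"
proof (induction "euclidean_size b" arbitrary: a b rule: less_induct)
  case less
  show ?case
  proof (cases "b = 0")
    case True
    then show ?thesis by (intro exI[of _ a] exI[of _ 1] exI[of _ 0]) auto
  next
    case False
    then obtain d x y where d: "d dvd b" "d dvd a mod b" "b * x + a mod b * y = d"
      using less[OF mod_size_less[OF False], of b a] by blast
    have "a * y + b * (x - a div b * y) = b * x + (a - a div b * b) * y"
      by (simp add: algebra_simps)
    also have "\<dots> = d"
      using d(3) by (simp add: minus_div_mult_eq_mod)
    finally have "a * y + b * (x - a div b * y) = d" .
    moreover have "d dvd a"
      using d(1,2) dvd_mod_iff by blast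
    ultimately show ?thesis
      using d(1) by blast
  qed
qed

lemma coprime_iff_ex_cong_inverse:
  fixes a m :: "'a :: unique_euclidean_ring"
  shows "coprime a m \<longleftrightarrow> (\<exists>x. [a * x = 1] (mod m))"
proof
  assume "coprime a m"
  obtain d x y where d: "d dvd a" "d dvd m" "a * x + m * y = d"
    using bezout_common_divisor by blast
  with \<open>coprime a m\<close> have "d dvd 1"
    by (auto intro: coprime_common_divisor)
  then obtain c where "1 = d * c" ..
  then have "1 = (a * x + m * y) * c"
    using d(3) by simp
  then have "1 = a * (x * c) + m * (y * c)"
    by (simp add: algebra_simps)
  then have "1 - a * (x * c) = m * (y * c)"
    by (metis add_diff_cancel_left')
  then have "[1 = a * (x * c)] (mod m)"
    by (simp add: cong_iff_dvd_diff)
  then have "[a * (x * c) = 1] (mod m)"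
    by (rule cong_sym)
  then show "\<exists>x. [a * x = 1] (mod m)" ..
next
  assume "\<exists>x. [a * x = 1] (mod m)"
  then obtain x where x: "m dvd a * x - 1"
    by (auto simp: cong_iff_dvd_diff)
  show "coprime a m"
  proof (rule coprimeI)
    fix c assume "c dvd a" "c dvd m"
    then have "c dvd a * x" "c dvd a * x - 1"
      using dvd_trans[OF _ x] by auto
    then have "c dvd a * x - (a * x - 1)"
      by (rule dvd_diff)
    then show "c dvd 1" by simp
  qed
qed

lemma cyclic_ring_simps [simp]:
  "carrier (cyclic_ring n) = {p. degree p < n}"
  "p \<otimes>\<^bsub>cyclic_ring n\<^esub> r = (p * r) mod cyclic_modulus n"
  "\<one>\<^bsub>cyclic_ring n\<^esub> = 1"
  "\<zero>\<^bsub>cyclic_ring n\<^esub> = 0"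
  "p \<oplus>\<^bsub>cyclic_ring n\<^esub> r = p + r"
  by (simp_all add: cyclic_ring_def)

lemma degree_mod_cyclic_modulus:
  assumes "n > 0"
  shows "degree (p mod cyclic_modulus n :: 'a :: field poly) < n"
  using degree_mod_less[of "cyclic_modulus n" p] degree_cyclic_modulus[OF assms, where ?'a = 'a] assms
  by (cases "p mod cyclic_modulus n = 0") fastforce+

lemma mod_cyclic_modulus_id:
  fixes p :: "'a :: field poly"
  assumes "degree p < n"
  shows "p mod cyclic_modulus n = p"
  using assms degree_cyclic_modulus[of n, where ?'a = 'a] by (simp add: mod_poly_less)

lemma cong_cyclic_modulus_imp_eq:
  fixes p r :: "'a :: field poly"
  assumes "degree p < n" "degree r < n" "[p = r] (mod cyclic_modulus n)"
  shows "p = r"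
  using assms by (simp add: cong_def mod_cyclic_modulus_id)

lemma finite_polys_degree_less: "finite {p :: 'a :: {finite,zero} poly. degree p < n}"
proof (rule finite_subset)
  show "{p :: 'a poly. degree p < n} \<subseteq> Poly ` {xs. set xs \<subseteq> UNIV \<and> length xs \<le> n}"
  proof
    fix p :: "'a poly" assume "p \<in> {p. degree p < n}"
    then have "length (coeffs p) \<le> n"
      by (cases "p = 0") (auto simp: length_coeffs_degree)
    then show "p \<in> Poly ` {xs. set xs \<subseteq> UNIV \<and> length xs \<le> n}"
      by (intro image_eqI[of _ _ "coeffs p"]) auto
  qed
qed (intro finite_imageI finite_lists_length_le, simp)

lemma finite_idempotents_cyclic_ring:
  "finite (idempotents (cyclic_ring n :: 'a :: finite_field poly ring))"
  by (rule finite_subset[OF _ finite_polys_degree_less[of n]]) (auto simp: idempotents_def)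

lemma finsum_cyclic_ring:
  fixes g :: "'b \<Rightarrow> 'a :: field poly"
  assumes n: "n > 0" and "finite I" and "\<And>i. i \<in> I \<Longrightarrow> degree (g i) < n"
  shows "finsum (cyclic_ring n) g I = sum g I"
proof -
  interpret cring "cyclic_ring n :: 'a poly ring"
    using n by (rule cring_cyclic_ring)
  from assms(2,3) show ?thesis
  proof (induction I rule: finite_induct)
    case empty
    then show ?case by simp
  next
    case (insert i I)
    then have "finsum (cyclic_ring n) g (insert i I) = g i \<oplus>\<^bsub>cyclic_ring n\<^esub> finsum (cyclic_ring n) g I"
      by (intro finsum_insert) auto
    with insert show ?case by simp
  qed
qed

lemma cong_finsum_cyclic_ring:
  fixes g h :: "'b \<Rightarrow> 'a :: field poly"
  assumes n: "n > 0" and "finite I"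
  shows "[(\<Sum>i\<in>I. g i * h i) = (\<Oplus>\<^bsub>cyclic_ring n\<^esub>i\<in>I. g i \<otimes>\<^bsub>cyclic_ring n\<^esub> h i)]
    (mod cyclic_modulus n)"
proof -
  have "(\<Oplus>\<^bsub>cyclic_ring n\<^esub>i\<in>I. g i \<otimes>\<^bsub>cyclic_ring n\<^esub> h i) = (\<Sum>i\<in>I. g i \<otimes>\<^bsub>cyclic_ring n\<^esub> h i)"
    using assms by (intro finsum_cyclic_ring) (auto simp: degree_mod_cyclic_modulus)
  then show ?thesis
    by (simp add: cong_def mod_sum_eq)
qed

lemma Units_cyclic_ring:
  fixes p :: "'a :: field poly"
  assumes n: "n > 0" and p: "p \<in> carrier (cyclic_ring n)" and cop: "coprime p (cyclic_modulus n)"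
  shows "p \<in> Units (cyclic_ring n)"
proof -
  obtain x where x: "[p * x = 1] (mod cyclic_modulus n)"
    using cop by (auto simp: coprime_iff_ex_cong_inverse)
  let ?y = "x mod cyclic_modulus n"
  have "?y \<in> carrier (cyclic_ring n)"
    using degree_mod_cyclic_modulus[OF n] by simp
  moreover have "p \<otimes>\<^bsub>cyclic_ring n\<^esub> ?y = \<one>\<^bsub>cyclic_ring n\<^esub>"
    using x mod_cyclic_modulus_id[of "1 :: 'a poly" n] n by (simp add: cong_def mod_mult_right_eq)
  moreover have "?y \<otimes>\<^bsub>cyclic_ring n\<^esub> p = p \<otimes>\<^bsub>cyclic_ring n\<^esub> ?y"
    by (simp add: mult.commute)
  ultimately show ?thesis
    unfolding Units_def using p by (intro CollectI conjI bexI[of _ ?y]) simp_all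
qed

lemma sum_primitive_idempotents_cyclic_ring:
  fixes e :: "'b \<Rightarrow> 'a :: finite_field poly"
  assumes n: "n > 0" and I: "finite I" and e: "bij_betw e I (primitive_idempotents (cyclic_ring n))"
  shows "(\<Sum>i\<in>I. e i) = 1"
proof -
  interpret cring "cyclic_ring n :: 'a poly ring"
    using n by (rule cring_cyclic_ring)
  have "degree (e i) < n" if "i \<in> I" for i
    using e that by (auto simp: bij_betw_def primitive_idempotents_def idempotents_def)
  then have "(\<Sum>i\<in>I. e i) = finsum (cyclic_ring n) e I"
    using n I by (simp add: finsum_cyclic_ring)
  also have "\<dots> = \<one>\<^bsub>cyclic_ring n\<^esub>"
    by (rule finsum_primitive_idempotents[OF finite_idempotents_cyclic_ring I e])
  finally show ?thesis by simp
qed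

lemma cyclic_ring_combination_inverse:
  fixes e u :: "'b \<Rightarrow> 'a :: finite_field poly"
  assumes n: "n > 0" and I: "finite I" and e: "bij_betw e I (primitive_idempotents (cyclic_ring n))"
    and u: "\<And>i. i \<in> I \<Longrightarrow> u i \<in> Units (cyclic_ring n)"
  shows "[(\<Sum>i\<in>I. u i * e i) * (\<Sum>i\<in>I. inv\<^bsub>cyclic_ring n\<^esub> (u i) * e i) = 1] (mod cyclic_modulus n)"
proof -
  let ?R = "cyclic_ring n :: 'a poly ring"
  interpret cring ?R
    using n by (rule cring_cyclic_ring)
  let ?A = "\<Oplus>\<^bsub>?R\<^esub>i\<in>I. u i \<otimes>\<^bsub>?R\<^esub> e i" and ?B = "\<Oplus>\<^bsub>?R\<^esub>i\<in>I. inv\<^bsub>?R\<^esub> (u i) \<otimes>\<^bsub>?R\<^esub> e i"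
  have "[(\<Sum>i\<in>I. u i * e i) * (\<Sum>i\<in>I. inv\<^bsub>?R\<^esub> (u i) * e i) = ?A * ?B] (mod cyclic_modulus n)"
    using n I by (intro cong_mult cong_finsum_cyclic_ring)
  moreover have "?A \<otimes>\<^bsub>?R\<^esub> ?B = \<one>\<^bsub>?R\<^esub>"
    by (rule combination_mult_inverse_combination[OF finite_idempotents_cyclic_ring I e u])
  then have "[?A * ?B = 1] (mod cyclic_modulus n)"
    using n by (simp only: cyclic_ring_simps) (simp add: cong_def mod_cyclic_modulus_id)
  ultimately show ?thesis by (rule cong_trans)
qed

section \<open>Polynomial functions on a finite field and compositional inverses\<close>

lemma degree_field_polynomial:
  "N > 1 \<Longrightarrow> degree (monom 1 N - monom 1 1 :: 'a :: field poly) = N"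
  using degree_add_eq_left[of "- monom 1 1" "monom (1 :: 'a) N"] by (simp add: degree_monom_eq)

lemma card_finite_field_gt_1: "CARD('a :: finite_field) > 1"
  using card_mono[of UNIV "{0, 1 :: 'a}"] by simp

text \<open>
  The polynomial \<open>x ^ N - x\<close> vanishes on the field with \<open>N\<close> elements, and the remainders modulo it have
  fewer than \<open>N\<close> roots unless they are zero.  Congruence modulo it is therefore equality of functions.
\<close>

lemma cong_field_polynomial_iff:
  fixes p r :: "'a :: finite_field poly"
  shows "[p = r] (mod (monom 1 CARD('a) - monom 1 1)) \<longleftrightarrow> (\<forall>x. poly p x = poly r x)"
proof -
  let ?m = "monom 1 CARD('a) - monom 1 1 :: 'a poly"
  have deg: "degree ?m = CARD('a)"
    using card_finite_field_gt_1 by (rule degree_field_polynomial)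
  have vanish: "poly ?m x = 0" for x :: 'a
    by (simp add: poly_monom finite_field_power_card_eq_same)
  have poly_mod: "poly (s mod ?m) x = poly s x" for s x
  proof -
    have "poly s x = poly (s div ?m * ?m + s mod ?m) x"
      by (simp only: div_mult_mod_eq)
    then show ?thesis
      by (simp only: poly_add poly_mult vanish mult_zero_right add_0)
  qed
  have deg_mod: "degree (s mod ?m) < CARD('a)" for s
    using degree_mod_less[of ?m s] deg by (cases "s mod ?m = 0") fastforce+
  show ?thesis
  proof
    assume "[p = r] (mod ?m)"
    then show "\<forall>x. poly p x = poly r x"
      by (metis cong_def poly_mod)
  next
    assume "\<forall>x. poly p x = poly r x"
    then have "p mod ?m = r mod ?m"
      by (intro poly_eqI_degree[of UNIV]) (simp_all only: poly_mod deg_mod)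
    then show "[p = r] (mod ?m)" by (simp add: cong_def)
  qed
qed

text \<open>
  Any competitor is an inverse of \<open>F\<close> as a function, so it agrees with \<open>G\<close> on more points than its degree.
\<close>

lemma compositional_inverse_eqI:
  fixes F G :: "'a :: finite_field poly"
  assumes "degree G < CARD('a)"
    and FG: "\<And>x. poly F (poly G x) = x" and GF: "\<And>x. poly G (poly F x) = x"
  shows "compositional_inverse CARD('a) F = G"
  unfolding compositional_inverse_def cong_field_polynomial_iff
proof (rule the_equality)
  fix H :: "'a poly"
  assume H: "degree H < CARD('a) \<and> (\<forall>x. poly (F \<circ>\<^sub>p H) x = poly (monom 1 1) x)
    \<and> (\<forall>x. poly (H \<circ>\<^sub>p F) x = poly (monom 1 1) x)"
  have "poly H x = poly G x" for x
    using H GF[of "poly H x"] by (simp add: poly_pcompose poly_monom)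
  then show "H = G"
    using H assms(1) by (intro poly_eqI_degree[of UNIV]) auto
qed (use assms in \<open>auto simp: poly_pcompose poly_monom\<close>)

section \<open>Linearized polynomials as operators\<close>

text \<open>
  A homomorphism into a field with \<open>q ^ n\<close> elements presents the latter as the extension of degree \<open>n\<close>
  of the field with \<open>q\<close> elements.
\<close>

locale frobenius_extension =
  fixes emb :: "'k :: finite_field \<Rightarrow> 'l :: finite_field" and q n :: nat
  assumes primepow_q: "primepow q" and n_pos: "n > 0"
    and card_k: "CARD('k) = q" and card_l: "CARD('l) = q ^ n"
    and emb_1: "emb 1 = 1"
    and emb_add: "\<And>x y. emb (x + y) = emb x + emb y"
    and emb_mult: "\<And>x y. emb (x * y) = emb x * emb y"
begin

lemma q_gt_1: "q > 1"
  using primepow_q by (rule primepow_gt_Suc_0[unfolded One_nat_def[symmetric]])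

lemma emb_0: "emb 0 = 0"
  using emb_add[of 0 0] by (metis add_0 add_right_cancel)

lemma emb_eq_0_iff: "emb x = 0 \<longleftrightarrow> x = 0"
proof
  assume "emb x = 0"
  then have "emb (x * inverse x) = 0"
    by (simp add: emb_mult)
  then show "x = 0"
    by (metis emb_1 right_inverse zero_neq_one)
qed (simp add: emb_0)

lemma emb_power: "emb (x ^ m) = emb x ^ m"
  by (induction m) (simp_all add: emb_1 emb_mult)

lemma emb_power_q: "emb x ^ q = emb x"
  using finite_field_power_card_eq_same[of x] card_k by (simp flip: emb_power)

lemma add_power_q: "(x + y) ^ q = x ^ q + y ^ q" for x y :: 'l
proof -
  obtain p k where p: "prime p" "q = p ^ k"
    using primepow_q by (auto simp: primepow_def)
  (* The cardinality of the large field is a power of p, so p is its characteristic. *)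
  have "CHAR('l) dvd p ^ (k * n)"
    using CHAR_dvd_CARD[where ?'a = 'l] card_l p by (simp add: power_mult)
  then have "CHAR('l) = p"
    using p(1) CHAR_prime[where ?'a = 'l] prime_dvd_power primes_dvd_imp_eq by blast
  then show ?thesis
    using freshmans_dream'[of q k x y] p by simp
qed

text \<open>
  The value at \<open>c\<close> of the linearized polynomial whose conventional \<open>q\<close>-associate is \<open>p\<close>.  Associates of
  every degree are admitted, so that this is an action of the whole polynomial ring before reduction
  modulo \<open>x ^ n - 1\<close>.
\<close>

definition operator :: "'k poly \<Rightarrow> 'l \<Rightarrow> 'l" where
  "operator p c = (\<Sum>i\<le>degree p. emb (coeff p i) * c ^ (q ^ i))"

lemma operator_altdef:
  assumes "degree p \<le> N"
  shows "operator p c = (\<Sum>i\<le>N. emb (coeff p i) * c ^ (q ^ i))"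
  unfolding operator_def
  by (rule sum.mono_neutral_left) (use assms in \<open>auto simp: coeff_eq_0 emb_0\<close>)

lemma operator_add: "operator (p + r) c = operator p c + operator r c"
proof -
  let ?N = "max (degree p) (degree r)"
  have "degree (p + r) \<le> ?N" by (rule degree_add_le_max)
  then show ?thesis
    by (simp add: operator_altdef[of _ ?N] emb_add distrib_right sum.distrib)
qed

lemma operator_smult: "operator (smult a p) c = emb a * operator p c"
  by (simp add: operator_altdef[of _ "degree p"] degree_smult_le emb_mult sum_distrib_left mult.assoc)

lemma operator_0 [simp]: "operator 0 c = 0"
  by (simp add: operator_def emb_0)

lemma operator_at_0 [simp]: "operator p 0 = 0"
  using q_gt_1 by (simp add: operator_def power_0_left)

lemma operator_monom: "operator (monom a i) c = emb a * c ^ (q ^ i)"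
proof -
  have "operator (monom a i) c = (\<Sum>j\<le>i. if j = i then emb a * c ^ (q ^ i) else 0)"
    unfolding operator_altdef[OF degree_monom_le] by (rule sum.cong) (auto simp: emb_0)
  then show ?thesis by simp
qed

lemma operator_pCons_0: "operator (pCons 0 p) c = operator p (c ^ q)"
proof -
  have "operator (pCons 0 p) c = (\<Sum>i\<le>Suc (degree p). emb (coeff (pCons 0 p) i) * c ^ (q ^ i))"
    by (rule operator_altdef[OF degree_pCons_le])
  also have "\<dots> = (\<Sum>i\<le>degree p. emb (coeff p i) * c ^ (q ^ Suc i))"
    by (subst sum.atMost_Suc_shift) (simp add: emb_0)
  also have "\<dots> = operator p (c ^ q)"
    by (simp add: operator_def power_mult)
  finally show ?thesis .
qed

lemma operator_pCons: "operator (pCons a p) c = emb a * c + operator p (c ^ q)"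
  using operator_add[of "monom a 0" "pCons 0 p" c] operator_monom[of a 0 c]
  by (simp add: operator_pCons_0 monom_0)

text \<open>
  The Frobenius map fixes the coefficients and is additive, hence commutes with every operator.  This is
  what makes the action of the commutative polynomial ring multiplicative.
\<close>

lemma operator_power_q: "operator p (c ^ q) = operator p c ^ q"
  by (induction p arbitrary: c)
    (use q_gt_1 in \<open>auto simp: operator_pCons add_power_q power_mult_distrib emb_power_q\<close>)

lemma operator_mult: "operator (p * r) c = operator p (operator r c)"
proof (induction p arbitrary: c)
  case (pCons a p)
  then show ?case
    by (simp add: operator_add operator_smult operator_pCons operator_pCons_0 operator_power_q emb_0)
qed simp

lemma operator_1 [simp]: "operator 1 c = c"
  using operator_monom[of 1 0 c] by (simp add: emb_1 monom_0 one_pCons)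

lemma operator_cyclic_modulus: "operator (cyclic_modulus n) c = 0"
proof -
  have "operator (cyclic_modulus n + 1) c = operator (cyclic_modulus n) c + operator 1 c"
    by (rule operator_add)
  moreover have "operator (monom 1 n) c = c"
    using finite_field_power_card_eq_same[of c] card_l by (simp add: operator_monom emb_1)
  ultimately show ?thesis by simp
qed

lemma operator_mod: "operator (p mod cyclic_modulus n) c = operator p c"
proof -
  have "operator p c = operator (p div cyclic_modulus n * cyclic_modulus n + p mod cyclic_modulus n) c"
    by (simp only: div_mult_mod_eq)
  then show ?thesis
    by (simp only: operator_add operator_mult operator_cyclic_modulus operator_at_0 add_0)
qed

lemma operator_q_associate:
  "operator (q_associate n a) c = poly (q_polynomial q n (\<lambda>i. emb (a i))) c"
proof -
  have "operator (\<Sum>i<m. monom (a i) i) c = (\<Sum>i<m. emb (a i) * c ^ (q ^ i))" for m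
    by (induction m) (simp_all add: operator_add operator_monom)
  then show ?thesis
    by (simp add: q_associate_def q_polynomial_def poly_sum poly_monom)
qed

lemma degree_q_polynomial: "degree (q_polynomial q n a) < q ^ n"
  unfolding q_polynomial_def
proof (rule degree_sum_less)
  fix i assume "i \<in> {..<n}"
  then show "degree (monom (a i) (q ^ i)) < q ^ n"
    using q_gt_1 by (intro le_less_trans[OF degree_monom_le] power_strict_increasing) auto
qed (use q_gt_1 in simp)

lemma coeff_q_polynomial:
  assumes "i < n"
  shows "coeff (q_polynomial q n a) (q ^ i) = a i"
proof -
  have "coeff (q_polynomial q n a) (q ^ i) = (\<Sum>j<n. if j = i then a i else 0)"
    unfolding q_polynomial_def coeff_sum
    using q_gt_1 by (intro sum.cong) auto
  then show ?thesis using assms by simp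
qed

lemma q_associate_coeff:
  assumes "degree (p :: 'k poly) < n"
  shows "q_associate n (coeff p) = p"
proof (rule poly_eqI)
  fix j
  show "coeff (q_associate n (coeff p)) j = coeff p j"
    using assms by (cases "j < n") (auto simp: q_associate_def coeff_sum coeff_eq_0)
qed

text \<open>
  The linearized polynomial has degree below \<open>q ^ n\<close>, the size of the field, so it vanishes everywhere only
  if it is zero.
\<close>

lemma operator_faithful:
  assumes "degree p < n" and "\<And>c. operator p c = 0"
  shows "p = 0"
proof -
  let ?P = "q_polynomial q n (\<lambda>i. emb (coeff p i))"
  have "?P = 0"
  proof (rule poly_eqI_degree[of UNIV])
    show "poly ?P c = poly 0 c" for c
      using assms operator_q_associate[of "coeff p" c] by (simp add: q_associate_coeff)
  qed (use degree_q_polynomial card_l q_gt_1 in auto)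
  then have "coeff p i = 0" if "i < n" for i
    using coeff_q_polynomial[OF that, of "\<lambda>i. emb (coeff p i)"] by (simp add: emb_eq_0_iff)
  then show ?thesis
    using assms(1) by (metis leading_coeff_0_iff)
qed

text \<open>
  If \<open>f\<close> acts injectively, faithfulness allows to cancel \<open>f\<close> in the cyclic ring.  An injective
  multiplication on a finite ring is onto and so reaches 1.
\<close>

lemma ex_cong_inverse_if_operator_inj:
  assumes "inj (operator f)"
  shows "\<exists>g. degree g < n \<and> [f * g = 1] (mod cyclic_modulus n)"
proof -
  let ?C = "{p :: 'k poly. degree p < n}"
  let ?mult = "\<lambda>g. (f * g) mod cyclic_modulus n"
  have "inj_on ?mult ?C"
  proof (rule inj_onI)
    fix g h assume gh: "g \<in> ?C" "h \<in> ?C" and eq: "?mult g = ?mult h"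
    have "operator f (operator g c) = operator f (operator h c)" for c
      using operator_mod[of "f * g" c] operator_mod[of "f * h" c] eq by (simp add: operator_mult)
    then have "operator g c = operator h c" for c
      using assms by (simp add: inj_eq)
    then have "operator (g - h) c = 0" for c
      using operator_add[of "g - h" h c] by simp
    then show "g = h"
      using operator_faithful[of "g - h"] gh by (simp add: degree_diff_less)
  qed
  moreover have "?mult ` ?C \<subseteq> ?C"
    using degree_mod_cyclic_modulus[OF n_pos] by auto
  ultimately have "?mult ` ?C = ?C"
    using finite_polys_degree_less by (intro endo_inj_surj)
  moreover have "1 \<in> ?C"
    using n_pos by simp
  ultimately obtain g where "g \<in> ?C" "?mult g = 1"
    by (metis (no_types, lifting) imageE)
  then show ?thesis
    using n_pos by (auto simp: cong_def mod_cyclic_modulus_id)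
qed

text \<open>
  Polynomials that are inverse modulo \<open>x ^ n - 1\<close> act as mutually inverse maps, and a map on the field
  determines its polynomial of degree below \<open>q ^ n\<close>.
\<close>

lemma compositional_inverse_q_polynomial:
  assumes "[q_associate n a * q_associate n b = 1] (mod cyclic_modulus n)"
  shows "compositional_inverse (q ^ n) (q_polynomial q n (\<lambda>i. emb (a i)))
    = q_polynomial q n (\<lambda>i. emb (b i))"
proof -
  have "operator (q_associate n a * q_associate n b) c = c" for c
  proof -
    have "operator (q_associate n a * q_associate n b) c = operator 1 c"
      using assms by (metis cong_def operator_mod)
    then show ?thesis by simp
  qed
  moreover from this have "operator (q_associate n b * q_associate n a) c = c" for c
    by (simp add: mult.commute)
  ultimately show ?thesis
    unfolding card_l[symmetric]
    using degree_q_polynomial card_l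
    by (intro compositional_inverse_eqI) (auto simp: operator_mult operator_q_associate)
qed

end

section \<open>Inverting linear permutations idempotent by idempotent\<close>

theorem theorem26:
  fixes q n t :: nat
    and emb :: "'k :: finite_field \<Rightarrow> 'l :: finite_field"
    and a :: "nat \<Rightarrow> 'k"
    and e :: "nat \<Rightarrow> 'k poly"
    and F :: "'l poly"
    and f :: "'k poly"
  assumes "primepow q" and "n > 0" and "coprime n q"
    and "CARD('k) = q" and "CARD('l) = q ^ n"
    and "emb 1 = 1"
    and "\<And>x y. emb (x + y) = emb x + emb y"
    and "\<And>x y. emb (x * y) = emb x * emb y"
    and "bij_betw e {1..t} (primitive_idempotents (cyclic_ring n))"
    and "F = q_polynomial q n (\<lambda>i. emb (a i))"
    and "permutation_polynomial F"
    and "f = q_associate n a"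
  shows "(\<exists>fs. coprime_family n t fs \<and> [f = (\<Sum>i=1..t. fs i * e i)] (mod cyclic_modulus n)) \<and>
    (\<exists>b :: nat \<Rightarrow> 'k.
       compositional_inverse (q ^ n) F = q_polynomial q n (\<lambda>i. emb (b i)) \<and>
       (\<forall>fs. coprime_family n t fs \<and> [f = (\<Sum>i=1..t. fs i * e i)] (mod cyclic_modulus n) \<longrightarrow>
          [q_associate n b = (\<Sum>i=1..t. inv\<^bsub>cyclic_ring n\<^esub> (fs i) * e i)] (mod cyclic_modulus n) \<and>
          (\<forall>g. degree g < n \<and> [g = (\<Sum>i=1..t. fs i * e i)] (mod cyclic_modulus n)
             \<longrightarrow> g = f) \<and>
          (\<forall>g. degree g < n \<and>
             [g = (\<Sum>i=1..t. inv\<^bsub>cyclic_ring n\<^esub> (fs i) * e i)] (mod cyclic_modulus n)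
             \<longrightarrow> g = q_associate n b)))"
proof -
  interpret frobenius_extension emb q n
    using assms(1,2,4-8) by unfold_locales
  have deg_assoc: "degree (q_associate n c) < n" for c :: "nat \<Rightarrow> 'k"
    unfolding q_associate_def using \<open>n > 0\<close>
    by (intro degree_sum_less) (auto intro: le_less_trans[OF degree_monom_le])
  have "poly F = operator f"
    using assms(10,12) operator_q_associate by auto
  then have "inj (operator f)"
    using assms(11) by (auto simp: permutation_polynomial_def bij_def)
  then obtain g where g: "degree g < n" "[f * g = 1] (mod cyclic_modulus n)"
    using ex_cong_inverse_if_operator_inj by blast
  have fg: "q_associate n (coeff g) = g"
    using g(1) by (rule q_associate_coeff)
  show ?thesis
  proof (intro conjI)
    have "coprime_family n t (\<lambda>_. f)"
      using g(2) deg_assoc assms(12)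
      by (auto simp: coprime_family_def coprime_iff_ex_cong_inverse)
    moreover have "(\<Sum>i=1..t. f * e i) = f"
      using sum_primitive_idempotents_cyclic_ring[OF assms(2) _ assms(9)]
      by (simp flip: sum_distrib_left)
    ultimately show "\<exists>fs. coprime_family n t fs \<and> [f = (\<Sum>i=1..t. fs i * e i)] (mod cyclic_modulus n)"
      by (intro exI[of _ "\<lambda>_. f"]) simp
  next
    show "\<exists>b :: nat \<Rightarrow> 'k.
       compositional_inverse (q ^ n) F = q_polynomial q n (\<lambda>i. emb (b i)) \<and>
       (\<forall>fs. coprime_family n t fs \<and> [f = (\<Sum>i=1..t. fs i * e i)] (mod cyclic_modulus n) \<longrightarrow>
          [q_associate n b = (\<Sum>i=1..t. inv\<^bsub>cyclic_ring n\<^esub> (fs i) * e i)] (mod cyclic_modulus n) \<and>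
          (\<forall>g. degree g < n \<and> [g = (\<Sum>i=1..t. fs i * e i)] (mod cyclic_modulus n)
             \<longrightarrow> g = f) \<and>
          (\<forall>g. degree g < n \<and>
             [g = (\<Sum>i=1..t. inv\<^bsub>cyclic_ring n\<^esub> (fs i) * e i)] (mod cyclic_modulus n)
             \<longrightarrow> g = q_associate n b))"
    proof (intro exI[of _ "coeff g"] conjI allI impI)
      show "compositional_inverse (q ^ n) F = q_polynomial q n (\<lambda>i. emb (coeff g i))"
        using compositional_inverse_q_polynomial[of a "coeff g"] g fg assms(10,12) by simp
    next
      fix fs h
      assume fs: "coprime_family n t fs \<and> [f = (\<Sum>i=1..t. fs i * e i)] (mod cyclic_modulus n)"
        and h: "degree h < n \<and> [h = (\<Sum>i=1..t. fs i * e i)] (mod cyclic_modulus n)"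
      have "[h = f] (mod cyclic_modulus n)"
        by (rule cong_trans[OF conjunct2[OF h] cong_sym[OF conjunct2[OF fs]]])
      then show "h = f"
        using h deg_assoc assms(12) by (intro cong_cyclic_modulus_imp_eq[of h n f]) simp_all
    next
      fix fs
      let ?G = "\<Sum>i=1..t. inv\<^bsub>cyclic_ring n\<^esub> (fs i) * e i"
      assume fs: "coprime_family n t fs \<and> [f = (\<Sum>i=1..t. fs i * e i)] (mod cyclic_modulus n)"
      have "[(\<Sum>i=1..t. fs i * e i) * ?G = 1] (mod cyclic_modulus n)"
      proof (rule cyclic_ring_combination_inverse[OF assms(2) _ assms(9)])
        fix i assume "i \<in> {1..t}"
        then show "fs i \<in> Units (cyclic_ring n)"
          using fs assms(2) unfolding coprime_family_def by (intro Units_cyclic_ring) blast+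
      qed simp
      then have fG: "[f * ?G = 1] (mod cyclic_modulus n)"
        by (rule cong_trans[OF cong_mult[OF conjunct2[OF fs] cong_refl]])
      (* g and ?G are both inverses of f, hence agree. *)
      have "[g * (f * ?G) = g] (mod cyclic_modulus n)"
        using cong_mult[OF cong_refl fG, of g] by simp
      moreover have "[g * (f * ?G) = ?G] (mod cyclic_modulus n)"
        using cong_mult[OF g(2) cong_refl, of ?G] by (simp only: mult_ac mult_1_left)
      ultimately have G: "[g = ?G] (mod cyclic_modulus n)"
        by (rule cong_trans[OF cong_sym])
      then show "[q_associate n (coeff g) = ?G] (mod cyclic_modulus n)"
        by (simp only: fg)
      fix h assume h: "degree h < n \<and> [h = ?G] (mod cyclic_modulus n)"
      have "[h = g] (mod cyclic_modulus n)"
        by (rule cong_trans[OF conjunct2[OF h] cong_sym[OF G]])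
      then show "h = q_associate n (coeff g)"
        unfolding fg using h g(1) by (intro cong_cyclic_modulus_imp_eq[of h n g]) simp_all
    qed
  qed
qed

end
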